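(* Let $G$ be a nearly abelian transcendental semigroup. Then for all $f\in G$ and all $\phi\in\Phi(G)$, there exists an affine map $\eta$ such that $f(\phi(z))=\eta(f(z))$ for almost all $z\in\mathbb{C}$.
   Context: A transcendental semigroup $G=\langle f_1,f_2,\ldots\rangle$ is the semigroup, under composition, generated by a family of transcendental entire functions. The Fatou set $F(G)$ is the largest open subset of $\mathbb{C}$ on which the family of functions in $G$ is normal (every sequence has a subsequence converging locally uniformly to a holomorphic function or to $\infty$). A transcendental semigroup $G$ is nearly abelian if there is a precompact family $\Phi$ of affine maps $z\mapsto az+b$ ($a\neq 0$), precompact in the space of affine maps with locally uniform convergence, such that (1) $\phi(F(G))=F(G)$ for every $\phi\in\Phi$; and (2) for every $f,g\in G$ there exists $\phi\in\Phi$ with $f\circ g=\phi\circ g\circ f$. The commutator set is $\Phi(G)=\{\phi \text{ affine}: \text{there are } f,g\in G \text{ such that } f\circ g=\phi\circ g\circ f\}$. An affine map is a map $z\mapsto az+b$ with $a,b\in\mathbb{C}$, $a\ne0$. "Almost all" is with respect to Lebesgue measure on $\mathbb{C}$. *)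

theory Defs
  imports "HOL-Analysis.Analysis"
begin

definition transcendental_entire :: "(complex \<Rightarrow> complex) \<Rightarrow> bool" where
  "transcendental_entire f \<longleftrightarrow>
     f holomorphic_on UNIV \<and> \<not> (\<exists>p :: complex poly. \<forall>z. f z = poly p z)"

inductive_set comp_semigroup :: "('a \<Rightarrow> 'a) set \<Rightarrow> ('a \<Rightarrow> 'a) set"
  for A :: "('a \<Rightarrow> 'a) set" where
  generator: "f \<in> A \<Longrightarrow> f \<in> comp_semigroup A"
| comp: "f \<in> comp_semigroup A \<Longrightarrow> g \<in> comp_semigroup A \<Longrightarrow> f \<circ> g \<in> comp_semigroup A"

text \<open>The generating family may have any cardinality.\<close>

definition transcendental_semigroup :: "(complex \<Rightarrow> complex) set \<Rightarrow> bool" where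
  "transcendental_semigroup G \<longleftrightarrow>
     (\<exists>A. A \<noteq> {} \<and> (\<forall>f\<in>A. transcendental_entire f) \<and> G = comp_semigroup A)"

text \<open>On open sets, uniform convergence on compact subsets is the same as locally uniform
  convergence.\<close>

definition loc_unif_limit ::
    "complex set \<Rightarrow> (nat \<Rightarrow> complex \<Rightarrow> complex) \<Rightarrow> (complex \<Rightarrow> complex) \<Rightarrow> bool" where
  "loc_unif_limit U s g \<longleftrightarrow>
     (\<forall>K. compact K \<and> K \<subseteq> U \<longrightarrow> uniform_limit K s g sequentially)"

definition loc_unif_to_infinity :: "complex set \<Rightarrow> (nat \<Rightarrow> complex \<Rightarrow> complex) \<Rightarrow> bool" where
  "loc_unif_to_infinity U s \<longleftrightarrow>
     (\<forall>K. compact K \<and> K \<subseteq> U \<longrightarrow> (\<forall>B. \<forall>\<^sub>F n in sequentially. \<forall>z\<in>K. B \<le> norm (s n z)))"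

text \<open>The alternative between a holomorphic limit and \<open>\<infinity>\<close> is taken on each connected component:
  one subsequence may tend to \<open>\<infinity>\<close> on one component and to a finite limit on another. With
  this reading normality is a local property, so a union of open sets of normality is again a
  set of normality, and \<open>fatou_set G\<close> below is the largest such set.\<close>

definition normal_family_on :: "complex set \<Rightarrow> (complex \<Rightarrow> complex) set \<Rightarrow> bool" where
  "normal_family_on U \<F> \<longleftrightarrow>
     (\<forall>s :: nat \<Rightarrow> complex \<Rightarrow> complex. range s \<subseteq> \<F> \<longrightarrow>
        (\<exists>r. strict_mono r \<and>
          (\<forall>C\<in>components U.
             (\<exists>g. g holomorphic_on C \<and> loc_unif_limit C (s \<circ> r) g) \<or>
             loc_unif_to_infinity C (s \<circ> r))))"

definition fatou_set :: "(complex \<Rightarrow> complex) set \<Rightarrow> complex set" where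
  "fatou_set G = \<Union>{U. open U \<and> normal_family_on U G}"

definition affine_map :: "(complex \<Rightarrow> complex) \<Rightarrow> bool" where
  "affine_map \<phi> \<longleftrightarrow> (\<exists>a b. a \<noteq> 0 \<and> \<phi> = (\<lambda>z. a * z + b))"

text \<open>Relative compactness, in sequential form, in the (metrizable) space of affine maps: limits
  need not lie in \<open>\<Phi>\<close>, but they must again be affine with nonzero linear coefficient.\<close>

definition precompact_affine :: "(complex \<Rightarrow> complex) set \<Rightarrow> bool" where
  "precompact_affine \<Phi> \<longleftrightarrow>
     (\<forall>\<phi>\<in>\<Phi>. affine_map \<phi>) \<and>
     (\<forall>s :: nat \<Rightarrow> complex \<Rightarrow> complex. range s \<subseteq> \<Phi> \<longrightarrow>
        (\<exists>r \<psi>. strict_mono r \<and> affine_map \<psi> \<and> loc_unif_limit UNIV (s \<circ> r) \<psi>))"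

definition nearly_abelian :: "(complex \<Rightarrow> complex) set \<Rightarrow> bool" where
  "nearly_abelian G \<longleftrightarrow>
     (\<exists>\<Phi>. precompact_affine \<Phi> \<and>
        (\<forall>\<phi>\<in>\<Phi>. \<phi> ` fatou_set G = fatou_set G) \<and>
        (\<forall>f\<in>G. \<forall>g\<in>G. \<exists>\<phi>\<in>\<Phi>. f \<circ> g = \<phi> \<circ> g \<circ> f))"

definition commutator_set :: "(complex \<Rightarrow> complex) set \<Rightarrow> (complex \<Rightarrow> complex) set" where
  "commutator_set G = {\<phi>. affine_map \<phi> \<and> (\<exists>f\<in>G. \<exists>g\<in>G. f \<circ> g = \<phi> \<circ> g \<circ> f)}"

end

theory Submission
  imports Defs "HOL-Complex_Analysis.Complex_Analysis"
begin

text \<open>For \<open>f\<close>, \<open>g\<close>, \<open>h\<close> in \<open>G\<close> with \<open>g \<circ> h = \<phi> \<circ> h \<circ> g\<close>, commuting \<open>f\<close> past \<open>g \<circ> h\<close> and past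
  \<open>h \<circ> g\<close> produces an affine \<open>\<eta>\<close> with \<open>f \<circ> \<phi> \<circ> (h \<circ> g) = \<eta> \<circ> f \<circ> (h \<circ> g)\<close>. The range of
  \<open>h \<circ> g\<close> is a nonempty open set, so the identity theorem yields \<open>f \<circ> \<phi> = \<eta> \<circ> f\<close> everywhere.\<close>

lemma affine_map_comp:
  assumes "affine_map \<phi>" "affine_map \<psi>"
  shows "affine_map (\<phi> \<circ> \<psi>)"
proof -
  obtain a b c d where *: "a \<noteq> 0" "c \<noteq> 0" "\<phi> = (\<lambda>z. a * z + b)" "\<psi> = (\<lambda>z. c * z + d)"
    using assms unfolding affine_map_def by blast
  then have "\<phi> \<circ> \<psi> = (\<lambda>z. (a * c) * z + (a * d + b))"
    by (auto simp: fun_eq_iff algebra_simps)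
  with * show ?thesis
    unfolding affine_map_def by (intro exI[of _ "a * c"] exI[of _ "a * d + b"]) simp
qed

text \<open>A left inverse is what cancels \<beta> in p = \<beta> \<circ> q, giving q = \<psi>
  \<circ> p.\<close>

lemma affine_map_left_inverse:
  assumes "affine_map \<phi>"
  obtains \<psi> where "affine_map \<psi>" "\<psi> \<circ> \<phi> = id"
proof -
  obtain a b where *: "a \<noteq> 0" "\<phi> = (\<lambda>z. a * z + b)"
    using assms unfolding affine_map_def by blast
  have "affine_map (\<lambda>z. inverse a * z + (- b / a))"
    unfolding affine_map_def using \<open>a \<noteq> 0\<close>
    by (intro exI[of _ "inverse a"] exI[of _ "- b / a"]) simp
  moreover have "(\<lambda>z. inverse a * z + (- b / a)) \<circ> \<phi> = id"
    using * by (auto simp: fun_eq_iff field_simps)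
  ultimately show thesis
    by (rule that)
qed

lemma affine_map_holomorphic: "affine_map \<phi> \<Longrightarrow> \<phi> holomorphic_on S"
  unfolding affine_map_def by (auto intro!: holomorphic_intros)

text \<open>The open mapping theorem applies because a constant map is the polynomial
  \<open>[:c:]\<close>, which transcendence excludes.\<close>

lemma transcendental_entire_open_image:
  assumes "transcendental_entire f" "open U"
  shows "open (f ` U)"
proof (rule open_mapping_thm[of f UNIV])
  show "f holomorphic_on UNIV"
    using assms by (simp add: transcendental_entire_def)
  show "\<not> f constant_on UNIV"
  proof
    assume "f constant_on UNIV"
    then obtain c where "\<forall>z. f z = poly [:c:] z"
      unfolding constant_on_def by auto
    with assms show False
      unfolding transcendental_entire_def by blast
  qed
qed (use assms in auto)

text \<open>Being entire and being an open map both pass directly to composites, so induction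
  carries them from the generators to the semigroup without asking whether a composite is again
  transcendental.\<close>

lemma comp_semigroup_entire_open:
  assumes "f \<in> comp_semigroup A" "\<And>f. f \<in> A \<Longrightarrow> transcendental_entire f"
  shows "f holomorphic_on UNIV \<and> (\<forall>U. open U \<longrightarrow> open (f ` U))"
  using assms(1)
proof induction
  case (generator f)
  with assms(2) show ?case
    using transcendental_entire_open_image by (auto simp: transcendental_entire_def)
next
  case (comp f g)
  then have "f holomorphic_on range g" "g holomorphic_on UNIV"
    by (auto elim: holomorphic_on_subset)
  then have "f \<circ> g holomorphic_on UNIV"
    by (intro holomorphic_on_compose)
  moreover have "open ((f \<circ> g) ` U)" if "open U" for U
    using comp.IH that unfolding image_comp[symmetric] by blast
  ultimately show ?case
    by blast
qed

lemma affine_semiconjugacy_on_range: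
  assumes comm: "\<And>f g. f \<in> G \<Longrightarrow> g \<in> G \<Longrightarrow> \<exists>\<phi>. affine_map \<phi> \<and> f \<circ> g = \<phi> \<circ> g \<circ> f"
    and closed: "\<And>f g. f \<in> G \<Longrightarrow> g \<in> G \<Longrightarrow> f \<circ> g \<in> G"
    and fgh: "f \<in> G" "g \<in> G" "h \<in> G"
    and \<phi>: "affine_map \<phi>" "g \<circ> h = \<phi> \<circ> h \<circ> g"
  shows "\<exists>\<eta>. affine_map \<eta> \<and> (\<forall>w. f (\<phi> (h (g w))) = \<eta> (f (h (g w))))"
proof -
  obtain \<alpha> where \<alpha>: "affine_map \<alpha>" "f \<circ> (g \<circ> h) = \<alpha> \<circ> (g \<circ> h) \<circ> f"
    using comm closed fgh by meson
  obtain \<beta> where \<beta>: "affine_map \<beta>" "f \<circ> (h \<circ> g) = \<beta> \<circ> (h \<circ> g) \<circ> f"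
    using comm closed fgh by meson
  obtain \<beta>' where \<beta>': "affine_map \<beta>'" "\<beta>' \<circ> \<beta> = id"
    using \<beta>(1) by (rule affine_map_left_inverse)
  \<comment> \<open>The witness comes from the chain f \<circ> \<phi> \<circ> h \<circ> g = f
    \<circ> g \<circ> h = \<alpha> \<circ> g \<circ> h \<circ> f = \<alpha> \<circ> \<phi> \<circ> h
    \<circ> g \<circ> f, in which h \<circ> g \<circ> f = \<beta>' \<circ> f \<circ> h \<circ>
    g.\<close>
  show ?thesis
  proof (intro exI[of _ "\<alpha> \<circ> \<phi> \<circ> \<beta>'"] conjI allI)
    show "affine_map (\<alpha> \<circ> \<phi> \<circ> \<beta>')"
      using \<alpha> \<beta>' \<phi> by (intro affine_map_comp)
    show "f (\<phi> (h (g w))) = (\<alpha> \<circ> \<phi> \<circ> \<beta>') (f (h (g w)))" for w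
      using \<alpha>(2) \<beta>(2) \<beta>'(2) \<phi>(2) by (simp add: fun_eq_iff)
  qed
qed

theorem theorem13:
  fixes G :: "(complex \<Rightarrow> complex) set"
  assumes "transcendental_semigroup G"
    and "nearly_abelian G"
  shows "\<forall>f\<in>G. \<forall>\<phi>\<in>commutator_set G.
           \<exists>\<eta>. affine_map \<eta> \<and> (AE z in lebesgue. f (\<phi> z) = \<eta> (f z))"
proof (intro ballI)
  fix f \<phi> assume f: "f \<in> G" and "\<phi> \<in> commutator_set G"
  then obtain g h where gh: "g \<in> G" "h \<in> G" and \<phi>: "affine_map \<phi>" "g \<circ> h = \<phi> \<circ> h \<circ> g"
    unfolding commutator_set_def by blast
  obtain A where A: "\<And>f. f \<in> A \<Longrightarrow> transcendental_entire f" "G = comp_semigroup A"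
    using assms(1) unfolding transcendental_semigroup_def by blast
  have closed: "p \<circ> q \<in> G" if "p \<in> G" "q \<in> G" for p q
    using that A(2) comp_semigroup.comp by blast
  have comm: "\<exists>\<psi>. affine_map \<psi> \<and> p \<circ> q = \<psi> \<circ> q \<circ> p" if "p \<in> G" "q \<in> G" for p q
    using that assms(2) unfolding nearly_abelian_def precompact_affine_def by meson
  obtain \<eta> where \<eta>: "affine_map \<eta>" "\<And>w. f (\<phi> (h (g w))) = \<eta> (f (h (g w)))"
    using affine_semiconjugacy_on_range[OF comm closed f gh \<phi>] by auto
  \<comment> \<open>The set is left arbitrary because composing with \<phi> asks for holomorphy of f
    on the image of \<phi>.\<close>
  have f_hol: "f holomorphic_on S" for S
    using comp_semigroup_entire_open[of f A] f A by (meson holomorphic_on_subset subset_UNIV)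
  \<comment> \<open>The composite lies in G, hence is an open map, and its range is the image of the
    whole plane.\<close>
  have "open (range (h \<circ> g))"
    using comp_semigroup_entire_open[of "h \<circ> g" A] closed[of h g] gh A by blast
  have "f (\<phi> z) = \<eta> (f z)" for z
  proof (rule analytic_continuation_open[of "range (h \<circ> g)" UNIV "\<lambda>z. f (\<phi> z)" "\<lambda>z. \<eta> (f z)"])
    show "(\<lambda>z. f (\<phi> z)) holomorphic_on UNIV" "(\<lambda>z. \<eta> (f z)) holomorphic_on UNIV"
      using holomorphic_on_compose[OF affine_map_holomorphic[OF \<phi>(1)] f_hol]
        holomorphic_on_compose[OF f_hol affine_map_holomorphic[OF \<eta>(1)]]
      by (simp_all add: o_def)
  qed (use \<open>open (range (h \<circ> g))\<close> \<eta>(2) in auto)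
  \<comment> \<open>The identity holds at every z, so the exceptional null set is empty.\<close>
  with \<eta>(1) show "\<exists>\<eta>. affine_map \<eta> \<and> (AE z in lebesgue. f (\<phi> z) = \<eta> (f z))"
    by auto
qed

end
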